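(* Let $N\ge 2$, let $0<f_1<\dots<f_N$ be real numbers (the available processor frequencies), and let $\lambda>0$, $P_I\ge 0$, $T>0$, $K>0$ be real numbers. Consider the problem of minimizing $$E(t_1,\dots,t_N)=\lambda\sum_{i=1}^N t_i f_i^3+P_I\Big(T-\sum_{i=1}^N t_i\Big)$$ over all real $(t_1,\dots,t_N)$ subject to $\sum_{i=1}^N t_i f_i=K$, $\sum_{i=1}^N t_i\le T$, and $t_i\ge 0$ for $i=1,\dots,N$. If $(t_1,\dots,t_N)$ is an optimal solution using exactly two frequencies $f_i<f_j$ (that is, $t_i>0$, $t_j>0$, and all other entries are zero), then $f_i$ and $f_j$ are adjacent, i.e. $j=i+1$.
   Context: A task needing $K$ clock ticks must be executed within available time $T$ on a processor with discrete frequencies $f_1<\dots<f_N$; $t_i$ is the time during which frequency $f_i$ is used. In the simplified model the power consumed at frequency $f$ is $\lambda f^3$, and $P_I$ is the power consumed while idle. *)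

theory Defs
  imports Complex_Main
begin

text \<open>
  Frequencies and usage times are families indexed by \<open>{1..N}\<close>, represented as functions on
  the natural numbers; values outside \<open>{1..N}\<close> play no role.
\<close>

definition energy ::
  "nat \<Rightarrow> (nat \<Rightarrow> real) \<Rightarrow> real \<Rightarrow> real \<Rightarrow> real \<Rightarrow> (nat \<Rightarrow> real) \<Rightarrow> real" where
  "energy N f lam P_I T t =
     lam * (\<Sum>i=1..N. t i * f i ^ 3) + P_I * (T - (\<Sum>i=1..N. t i))"

definition feasible ::
  "nat \<Rightarrow> (nat \<Rightarrow> real) \<Rightarrow> real \<Rightarrow> real \<Rightarrow> (nat \<Rightarrow> real) \<Rightarrow> bool" where
  "feasible N f T K t \<longleftrightarrow>
     (\<Sum>i=1..N. t i * f i) = K \<and> (\<Sum>i=1..N. t i) \<le> T \<and> (\<forall>i\<in>{1..N}. 0 \<le> t i)"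

end

theory Submission
  imports Defs
begin

text \<open>
  If some \<open>f k\<close> lay strictly between \<open>f i\<close> and \<open>f j\<close>, time could be moved from \<open>i\<close> and \<open>j\<close> to \<open>k\<close> in
  the proportions in which \<open>f k\<close> is a convex combination of \<open>f i\<close> and \<open>f j\<close>. This preserves both the
  total time and the number of clock ticks, hence also the idle energy, but strict convexity of
  the cube makes it strictly decrease the energy.
\<close>

text \<open>The right side minus the left factors as
  \<open>(c - a) * (c - b) * (b - a) * (a + b + c)\<close>, a product of positive terms. This is
  strict convexity with denominators cleared.\<close>

lemma cube_interpolation:
  fixes a b c :: real
  assumes "0 < a" "a < b" "b < c"
  shows "b ^ 3 * (c - a) < a ^ 3 * (c - b) + c ^ 3 * (b - a)"
proof -
  have "0 < (c - a) * (c - b) * (b - a) * (a + b + c)"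
    using assms by simp
  also have "\<dots> = a ^ 3 * (c - b) + c ^ 3 * (b - a) - b ^ 3 * (c - a)"
    by (simp add: algebra_simps power3_eq_cube)
  finally show ?thesis by simp
qed

text \<open>The weight \<open>g\<close> is left arbitrary so that one computation covers total time,
  clock ticks and the cubic energy term.\<close>

lemma sum_three_point_update:
  fixes t g :: "'a \<Rightarrow> real"
  assumes "finite A" "i \<in> A" "j \<in> A" "k \<in> A" "distinct [i, j, k]"
  shows "(\<Sum>m\<in>A. (t(i := t i + x, j := t j + y, k := t k + z)) m * g m) =
    (\<Sum>m\<in>A. t m * g m) + x * g i + y * g j + z * g k"
proof -
  have "(\<Sum>m\<in>A. (t(i := t i + x, j := t j + y, k := t k + z)) m * g m) =
    (\<Sum>m\<in>A. t m * g m + (if m = i then x * g i else 0)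
      + (if m = j then y * g j else 0) + (if m = k then z * g k else 0))"
    using assms by (intro sum.cong) (auto simp: algebra_simps)
  then show ?thesis
    using assms by (simp add: sum.distrib)
qed

lemma not_optimal_if_intermediate_frequency:
  fixes f t :: "nat \<Rightarrow> real"
  assumes ijk: "i \<in> {1..N}" "j \<in> {1..N}" "k \<in> {1..N}"
    and f: "0 < f i" "f i < f k" "f k < f j"
    and lam: "0 < lam"
    and t: "0 < t i" "0 < t j"
  shows "\<not> is_arg_min (energy N f lam P_I T) (feasible N f T K) t"
proof
  assume "is_arg_min (energy N f lam P_I T) (feasible N f T K) t"
  then have feas: "feasible N f T K t"
    and opt: "\<And>s. feasible N f T K s \<Longrightarrow> \<not> energy N f lam P_I T s < energy N f lam P_I T t"
    by (auto simp: is_arg_min_def)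
  \<comment> \<open>The largest scale at which the amounts taken from \<open>t i\<close> and
    \<open>t j\<close> in \<open>s\<close> leave both entries nonnegative.\<close>
  define e where "e = min (t i / (f j - f k)) (t j / (f k - f i))"
  have e: "0 < e" "e * (f j - f k) \<le> t i" "e * (f k - f i) \<le> t j"
    using f t by (simp_all add: e_def flip: pos_le_divide_eq)
  define s where "s = t(i := t i + - (e * (f j - f k)), j := t j + - (e * (f k - f i)),
    k := t k + e * (f j - f i))"
  have "distinct [i, j, k]"
    using f by auto
  \<comment> \<open>The factor after \<open>e\<close> measures how far \<open>g\<close> is from
    affine at the three frequencies: it vanishes for \<open>g\<close> constant or equal to
    \<open>f\<close>, and is negative for the cube of \<open>f\<close>.\<close>
  then have sum_s: "(\<Sum>m=1..N. s m * g m) = (\<Sum>m=1..N. t m * g m) +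
      e * (g k * (f j - f i) - (g i * (f j - f k) + g j * (f k - f i)))" for g
    unfolding s_def using ijk
    by (subst sum_three_point_update) (simp_all only: finite_atLeastAtMost, simp add: algebra_simps)
  have time: "(\<Sum>m=1..N. s m) = (\<Sum>m=1..N. t m)"
    using sum_s[of "\<lambda>_. 1"] by simp
  have ticks: "(\<Sum>m=1..N. s m * f m) = (\<Sum>m=1..N. t m * f m)"
    using sum_s[of f] by (simp add: algebra_simps)
  have nonneg: "0 \<le> s m" if "m \<in> {1..N}" for m
    using feas e f ijk that by (auto simp: s_def feasible_def)
  have "feasible N f T K s"
    using feas time ticks nonneg by (simp add: feasible_def)
  moreover have "(\<Sum>m=1..N. s m * f m ^ 3) < (\<Sum>m=1..N. t m * f m ^ 3)"
    using sum_s[of "\<lambda>m. f m ^ 3"] cube_interpolation[OF f] e(1)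
    by (simp add: mult_less_0_iff)
  then have "energy N f lam P_I T s < energy N f lam P_I T t"
    using lam time by (simp add: energy_def)
  ultimately show False
    using opt by blast
qed

theorem theorem5:
  fixes N :: nat and f t :: "nat \<Rightarrow> real" and lam P_I T K :: real and i j :: nat
  assumes "2 \<le> N"
    and "\<forall>k\<in>{1..N}. 0 < f k"
    and "strict_mono_on {1..N} f"
    and "0 < lam" and "0 \<le> P_I" and "0 < T" and "0 < K"
    and "is_arg_min (energy N f lam P_I T) (feasible N f T K) t"
    and "i \<in> {1..N}" and "j \<in> {1..N}" and "f i < f j"
    and "0 < t i" and "0 < t j"
    and "\<forall>k\<in>{1..N} - {i, j}. t k = 0"
  shows "j = i + 1"
proof (rule ccontr)
  assume "j \<noteq> i + 1"
  moreover have "i < j"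
    using assms(3,9-11) by (simp add: strict_mono_on_less)
  \<comment> \<open>The successor of \<open>i\<close> is the intermediate index: it differs from
    \<open>j\<close>, so it lies strictly below \<open>j\<close>.\<close>
  ultimately have k: "i < i + 1" "i + 1 < j" "i + 1 \<in> {1..N}"
    using \<open>j \<in> {1..N}\<close> by auto
  then have "f i < f (i + 1)" "f (i + 1) < f j"
    using assms(3,9,10) by (auto intro: strict_mono_onD)
  then show False
    using not_optimal_if_intermediate_frequency[of i N j "i + 1" f lam t P_I T K] assms k by auto
qed

end
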